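(* The convergence rate of any nodal approximation to a scalable functional $\lambda$ of scaling order $s$ on $W_2^m(\mathbb{R}^d)$ with $m>d/2$ is at most $m-s-d/2$.
   Context: $W_2^m(\mathbb{R}^d)$ is the usual $L_2$-based Sobolev space of order $m$; since $m>d/2$, point evaluations are well-defined and continuous on it. A functional $\lambda\in W_2^m(\mathbb{R}^d)^*$ is scalable of scaling order (scalability order) $s$ if $\lambda(u(h\,\cdot))=h^s\lambda(u)$ for all $u$ in the space and all $0<h\le 1$. For a finite node set $X=\{x_1,\dots,x_M\}\subset\mathbb{R}^d$, a nodal approximation to $\lambda$ on the scaled sets $hX=\{hx_1,\dots,hx_M\}$ consists of functionals $\lambda_{a(h),hX}(u)=\sum_{j=1}^M a_j(h)\,u(hx_j)$ with weight vectors $a(h)\in\mathbb{R}^M$ that may depend on $h$ in an arbitrary way. Its error functionals are $\epsilon_h=\lambda-\lambda_{a(h),hX}$, and it has convergence rate $k$ if $\|\epsilon_h\|_{W_2^m(\mathbb{R}^d)^*}\le C h^k$ holds for $h\to 0$ with a constant $C$.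
   Formalization: The functional λ is assumed nonzero and, if 0 is one of the nodes in X, not a multiple of point evaluation at 0; in these excluded cases suitable weights give zero error, hence every convergence rate, so the claim fails. *)

theory Defs
  imports "HOL-Analysis.Analysis"
begin

text \<open>
  Fourier transform of a real function restricted to the ball of radius \<open>R\<close> (unitary normalization).
  The transform of a square integrable function is the limit of these in the mean; it is determined
  up to a null set. The limit is stated with the nonnegative integral, so that a difference that
  is not square integrable counts as infinite.
\<close>

definition truncated_fourier :: "('a::euclidean_space \<Rightarrow> real) \<Rightarrow> real \<Rightarrow> 'a \<Rightarrow> complex" where
  "truncated_fourier u R \<omega> =
     of_real ((2 * pi) powr (- (real DIM('a) / 2))) *
     (LINT x:cball 0 R|lborel. of_real (u x) * cis (- (x \<bullet> \<omega>)))"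

definition is_L2_fourier :: "('a::euclidean_space \<Rightarrow> real) \<Rightarrow> ('a \<Rightarrow> complex) \<Rightarrow> bool" where
  "is_L2_fourier u g \<longleftrightarrow>
     g \<in> borel_measurable lborel \<and>
     integrable lborel (\<lambda>\<omega>. (cmod (g \<omega>))\<^sup>2) \<and>
     ((\<lambda>R. \<integral>\<^sup>+ \<omega>. ennreal ((cmod (g \<omega> - truncated_fourier u R \<omega>))\<^sup>2) \<partial>lborel) \<longlongrightarrow> 0) at_top"

definition L2_fourier :: "('a::euclidean_space \<Rightarrow> real) \<Rightarrow> 'a \<Rightarrow> complex" where
  "L2_fourier u = (SOME g. is_L2_fourier u g)"

text \<open>
  The Sobolev space \<open>W_2^m(R^d)\<close>, \<open>d = DIM('a)\<close>, of real order \<open>m\<close>: square integrable \<open>u\<close>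
  whose transform is square integrable with weight \<open>(1 + |\<omega>|^2)^m\<close>. For \<open>m > d/2\<close> every class has
  exactly one continuous representative. The elements below are these representatives, so point
  evaluation is ordinary function application. The definition is used only for \<open>m > d/2\<close>.
\<close>

definition sobolev_space :: "real \<Rightarrow> ('a::euclidean_space \<Rightarrow> real) set" where
  "sobolev_space m =
     {u. continuous_on UNIV u \<and> integrable lborel (\<lambda>x. (u x)\<^sup>2) \<and>
         (\<exists>g. is_L2_fourier u g \<and>
              integrable lborel (\<lambda>\<omega>. (1 + (norm \<omega>)\<^sup>2) powr m * (cmod (g \<omega>))\<^sup>2))}"

definition sobolev_norm :: "real \<Rightarrow> ('a::euclidean_space \<Rightarrow> real) \<Rightarrow> real" where
  "sobolev_norm m u =
     sqrt (LINT \<omega>|lborel. (1 + (norm \<omega>)\<^sup>2) powr m * (cmod (L2_fourier u \<omega>))\<^sup>2)"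

text \<open>Functionals are total on the function type; only their values on the Sobolev space matter.\<close>

definition sobolev_dual :: "real \<Rightarrow> (('a::euclidean_space \<Rightarrow> real) \<Rightarrow> real) set" where
  "sobolev_dual m =
     {\<Lambda>. (\<forall>u\<in>sobolev_space m. \<forall>v\<in>sobolev_space m. \<Lambda> (\<lambda>x. u x + v x) = \<Lambda> u + \<Lambda> v) \<and>
         (\<forall>c. \<forall>u\<in>sobolev_space m. \<Lambda> (\<lambda>x. c * u x) = c * \<Lambda> u) \<and>
         (\<exists>C. \<forall>u\<in>sobolev_space m. \<bar>\<Lambda> u\<bar> \<le> C * sobolev_norm m u)}"

text \<open>Extended-valued, so that an unbounded functional has norm \<open>\<infinity>\<close>.\<close>

definition sobolev_dual_norm :: "real \<Rightarrow> (('a::euclidean_space \<Rightarrow> real) \<Rightarrow> real) \<Rightarrow> ennreal" where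
  "sobolev_dual_norm m \<Lambda> =
     (SUP u \<in> {u \<in> sobolev_space m. sobolev_norm m u \<le> 1}. ennreal \<bar>\<Lambda> u\<bar>)"

definition scalable :: "real \<Rightarrow> real \<Rightarrow> (('a::euclidean_space \<Rightarrow> real) \<Rightarrow> real) \<Rightarrow> bool" where
  "scalable m s \<Lambda> \<longleftrightarrow>
     \<Lambda> \<in> sobolev_dual m \<and>
     (\<forall>u\<in>sobolev_space m. \<forall>h. 0 < h \<and> h \<le> 1 \<longrightarrow> \<Lambda> (\<lambda>x. u (h *\<^sub>R x)) = h powr s * \<Lambda> u)"

text \<open>
  Weights are indexed by the nodes of the unscaled set: \<open>w x\<close> belongs to the node \<open>h *\<^sub>R x\<close>.
\<close>

definition nodal_functional ::
    "('a::euclidean_space \<Rightarrow> real) \<Rightarrow> 'a set \<Rightarrow> real \<Rightarrow> ('a \<Rightarrow> real) \<Rightarrow> real" where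
  "nodal_functional w X h u = (\<Sum>x\<in>X. w x * u (h *\<^sub>R x))"

definition has_convergence_rate ::
    "real \<Rightarrow> (('a::euclidean_space \<Rightarrow> real) \<Rightarrow> real) \<Rightarrow> 'a set \<Rightarrow> (real \<Rightarrow> 'a \<Rightarrow> real) \<Rightarrow> real \<Rightarrow> bool" where
  "has_convergence_rate m \<Lambda> X a k \<longleftrightarrow>
     (\<exists>C\<ge>0. \<forall>\<^sub>F h in at_right 0.
        sobolev_dual_norm m (\<lambda>u. \<Lambda> u - nodal_functional (a h) X h u) \<le> ennreal (C * h powr k))"

end

theory Submission
  imports Defs "HOL-Probability.Sinc_Integral" "HOL-Computational_Algebra.Polynomial"
begin

text \<open>
  Choose \<open>u\<close> in the Sobolev space that vanishes on \<open>X\<close> with \<open>\<Lambda> u \<noteq> 0\<close>. The function \<open>u(\<cdot> / h)\<close>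
  vanishes on \<open>hX\<close>, so no weights can see it. By scalability \<open>\<Lambda>\<close> takes the value \<open>h powr (-s) * \<Lambda> u\<close>
  on it, while its norm is at most \<open>h powr (d/2 - m)\<close> times that of \<open>u\<close>. Hence the error functional has norm at
  least a constant times \<open>h powr (m - s - d/2)\<close>.

  If no such \<open>u\<close> existed, \<open>\<Lambda>\<close> would be a combination of evaluations at points of \<open>X\<close>; scalability then
  kills the weights at nonzero points, leaving a multiple of the evaluation at 0.

  Points are separated by tensor products of powers of truncated parabolas. Their compact support
  makes the truncated Fourier transforms eventually constant, so that no Plancherel theorem is needed, and
  repeated integration by parts gives the decay of the transform.
\<close>

section \<open>Lebesgue integrals under dilations and for products of one-variable functions\<close>

lemma nn_integral_lborel_scaleR:
  fixes f :: "'a::euclidean_space \<Rightarrow> ennreal"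
  assumes [measurable]: "f \<in> borel_measurable borel" and "h > 0"
  shows "(\<integral>\<^sup>+x. f x \<partial>lborel) = ennreal (h ^ DIM('a)) * (\<integral>\<^sup>+x. f (h *\<^sub>R x) \<partial>lborel)"
  by (subst lborel_affine[of h 0])
     (use assms(2) in \<open>simp_all add: nn_integral_density nn_integral_distr nn_integral_cmult ennreal_power\<close>)

lemma integrable_lborel_scaleR:
  fixes f :: "'a::euclidean_space \<Rightarrow> 'b::{banach, second_countable_topology}"
  assumes f: "integrable lborel f" and h: "h > 0"
  shows "integrable lborel (\<lambda>x. f (h *\<^sub>R x))"
proof -
  note [measurable] = borel_measurable_integrable[OF f]
  have "(\<integral>\<^sup>+x. ennreal (norm (f x)) \<partial>lborel) < \<infinity>"
    using f by (simp add: integrable_iff_bounded)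
  then have "(\<integral>\<^sup>+x. ennreal (norm (f (h *\<^sub>R x))) \<partial>lborel) < \<infinity>"
    using h by (subst (asm) nn_integral_lborel_scaleR[OF _ h])
      (auto simp: ennreal_mult_less_top ennreal_eq_0_iff linorder_not_less[symmetric])
  then show ?thesis by (simp add: integrable_iff_bounded)
qed

text \<open>Holds without an integrability assumption: a positive dilation and its inverse both
  preserve integrability, so if one side fails to be integrable, both integrals have the default
  value 0.\<close>

lemma integral_lborel_scaleR:
  fixes f :: "'a::euclidean_space \<Rightarrow> 'b::{banach, second_countable_topology}"
  assumes h: "h > 0"
  shows "(LINT x|lborel. f x) = h ^ DIM('a) *\<^sub>R (LINT x|lborel. f (h *\<^sub>R x))"
proof (cases "integrable lborel f")
  case True
  note [measurable] = borel_measurable_integrable[OF True]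
  show ?thesis
    using h integrable_lborel_scaleR[OF True h]
    by (subst lborel_affine[of h 0]) (simp_all add: integral_density integral_distr)
next
  case False
  then have "\<not> integrable lborel (\<lambda>x. f (h *\<^sub>R x))"
    using integrable_lborel_scaleR[of "\<lambda>x. f (h *\<^sub>R x)" "inverse h"] h by auto
  with False show ?thesis by (simp add: not_integrable_integral_eq)
qed

text \<open>Fubini in coordinates: \<open>lborel\<close> is the image of the product of
  one-dimensional Lebesgue measures indexed by \<open>Basis\<close>, and the integrand splits along
  the coordinates.\<close>

lemma
  fixes f :: "'a::euclidean_space \<Rightarrow> real \<Rightarrow> 'b::{real_normed_field,banach,second_countable_topology}"
  assumes f: "\<And>b. b \<in> Basis \<Longrightarrow> integrable lborel (f b)"
  shows integrable_lborel_prod: "integrable lborel (\<lambda>x. \<Prod>b\<in>Basis. f b (x \<bullet> b))"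
    and integral_lborel_prod:
      "(LINT x|lborel. (\<Prod>b\<in>Basis. f b (x \<bullet> b))) = (\<Prod>b\<in>Basis. (LINT t|lborel. f b t))"
proof -
  interpret product_sigma_finite "\<lambda>_::'a. lborel :: real measure" ..
  have m: "f b \<in> borel_measurable borel" if "b \<in> Basis" for b
    using borel_measurable_integrable[OF f[OF that]] by simp
  have [measurable]: "(\<lambda>x. \<Prod>b\<in>Basis. f b (x \<bullet> b)) \<in> borel_measurable borel"
    by (intro borel_measurable_prod measurable_compose[OF _ m]) auto
  have eq: "(\<Prod>b\<in>Basis. f b ((\<Sum>c\<in>Basis. w c *\<^sub>R c) \<bullet> b)) = (\<Prod>b\<in>Basis. f b (w b))" for w
    by (intro prod.cong) auto
  show "integrable lborel (\<lambda>x. \<Prod>b\<in>Basis. f b (x \<bullet> b))"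
    by (subst lborel_eq, subst integrable_distr_eq)
       (use product_integrable_prod[OF finite_Basis f] in \<open>simp_all add: eq cong: prod.cong\<close>)
  show "(LINT x|lborel. (\<Prod>b\<in>Basis. f b (x \<bullet> b))) = (\<Prod>b\<in>Basis. (LINT t|lborel. f b t))"
    by (subst lborel_eq, subst integral_distr)
       (use product_integral_prod[OF finite_Basis f] in \<open>simp_all add: eq cong: prod.cong\<close>)
qed

section \<open>Fourier transforms and dilations\<close>

text \<open>The integrand is jointly measurable in frequency and position, and integrating out one
  variable preserves measurability in the other.\<close>

lemma truncated_fourier_measurable [measurable]:
  fixes u :: "'a::euclidean_space \<Rightarrow> real"
  assumes [measurable]: "u \<in> borel_measurable borel"
  shows "truncated_fourier u R \<in> borel_measurable borel"
proof -
  have "(\<lambda>p. cis (- (snd p \<bullet> fst p))) \<in> borel_measurable (borel :: ('a \<times> 'a) measure)"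
    by (intro borel_measurable_continuous_onI continuous_intros)
  moreover have "(\<lambda>p. indicator (cball 0 R) (snd p) * u (snd p)) \<in> borel_measurable (borel :: ('a \<times> 'a) measure)"
    unfolding borel_prod[symmetric]
    by (rule measurable_compose[OF measurable_snd])
      (intro borel_measurable_times borel_measurable_indicator assms borel_closed closed_cball)
  ultimately have "(\<lambda>p. of_real (indicator (cball 0 R) (snd p) * u (snd p)) * cis (- (snd p \<bullet> fst p)))
      \<in> borel_measurable (borel :: ('a \<times> 'a) measure)"
    by (intro borel_measurable_times) (rule measurable_compose[OF _ borel_measurable_of_real])
  \<comment> \<open>The parametric integral needs the product sigma-algebra with
    \<open>lborel\<close> as second factor; it has the same sets as the Borel sigma-algebra of the
    product space.\<close>
  then have "(\<lambda>p. indicator (cball 0 R) (snd p) *\<^sub>R (complex_of_real (u (snd p)) * cis (- (snd p \<bullet> fst p))))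
      \<in> borel_measurable (borel \<Otimes>\<^sub>M lborel :: ('a \<times> 'a) measure)"
    by (simp add: measurable_cong_sets[OF sets_pair_measure_cong[OF refl sets_lborel] refl]
        borel_prod scaleR_conv_of_real mult.assoc)
  then show ?thesis
    unfolding truncated_fourier_def[abs_def] set_lebesgue_integral_def
    by (intro borel_measurable_times borel_measurable_const lborel.borel_measurable_lebesgue_integral)
      (simp add: split_beta')
qed

text \<open>A continuous integrand is integrable on the compact ball; this is what makes the
  truncated transform additive on continuous functions.\<close>

lemma set_integrable_fourier_kernel:
  fixes u :: "'a::euclidean_space \<Rightarrow> real"
  assumes "continuous_on UNIV u"
  shows "set_integrable lborel (cball 0 R) (\<lambda>x. of_real (u x) * cis (- (x \<bullet> \<omega>)))"
  unfolding set_integrable_def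
  by (intro borel_integrable_compact continuous_intros continuous_on_subset[OF assms]) auto

lemma truncated_fourier_add:
  assumes "continuous_on UNIV u" "continuous_on UNIV v"
  shows "truncated_fourier (\<lambda>x. u x + v x) R \<omega> = truncated_fourier u R \<omega> + truncated_fourier v R \<omega>"
  unfolding truncated_fourier_def
  using set_integral_add(2)[OF set_integrable_fourier_kernel[OF assms(1)]
      set_integrable_fourier_kernel[OF assms(2)], of R \<omega> \<omega>]
  by (simp add: algebra_simps)

lemma truncated_fourier_cmult:
  "truncated_fourier (\<lambda>x. c * u x) R \<omega> = of_real c * truncated_fourier u R \<omega>"
  unfolding truncated_fourier_def by (simp add: mult.assoc)

text \<open>Substituting \<open>h *\<^sub>R x\<close> for \<open>x\<close> shrinks the ball to
  radius \<open>R / h\<close>, moves the factor \<open>h\<close> onto the frequency and contributes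
  the Jacobian.\<close>

lemma truncated_fourier_dilate:
  fixes u :: "'a::euclidean_space \<Rightarrow> real"
  assumes h: "h > 0"
  shows "truncated_fourier (\<lambda>x. u (x /\<^sub>R h)) R \<omega> =
    of_real (h ^ DIM('a)) * truncated_fourier u (R / h) (h *\<^sub>R \<omega>)"
proof -
  have "indicator (cball 0 R) (h *\<^sub>R x) = (indicator (cball 0 (R / h)) x :: real)" for x :: 'a
    using h by (auto simp: indicator_def field_simps)
  then show ?thesis
    unfolding truncated_fourier_def set_lebesgue_integral_def
    using h by (subst integral_lborel_scaleR[OF h]) (simp add: scaleR_conv_of_real)
qed

section \<open>Linearity, dilation and uniqueness of the L2 Fourier transform\<close>

text \<open>A crude substitute for Minkowski's inequality. The factor 2 does no harm, since the
  bound only serves to show finiteness and convergence to 0.\<close>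

lemma norm_add_power2_le:
  fixes x y :: "'a::real_normed_vector"
  shows "(norm (x + y))\<^sup>2 \<le> 2 * (norm x)\<^sup>2 + 2 * (norm y)\<^sup>2"
proof -
  have "(norm (x + y))\<^sup>2 \<le> (norm x + norm y)\<^sup>2"
    by (intro power_mono norm_triangle_ineq) auto
  also have "\<dots> \<le> 2 * (norm x)\<^sup>2 + 2 * (norm y)\<^sup>2"
    using sum_squares_bound[of "norm x" "norm y"] by (simp add: power2_sum)
  finally show ?thesis .
qed

lemma nn_integral_cmod_add_sq:
  fixes f g :: "'a::euclidean_space \<Rightarrow> complex"
  assumes [measurable]: "f \<in> borel_measurable borel" "g \<in> borel_measurable borel"
  shows "(\<integral>\<^sup>+x. ennreal ((cmod (f x + g x))\<^sup>2) \<partial>lborel) \<le>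
    2 * (\<integral>\<^sup>+x. ennreal ((cmod (f x))\<^sup>2) \<partial>lborel) + 2 * (\<integral>\<^sup>+x. ennreal ((cmod (g x))\<^sup>2) \<partial>lborel)"
proof -
  have "(\<integral>\<^sup>+x. ennreal ((cmod (f x + g x))\<^sup>2) \<partial>lborel) \<le>
     (\<integral>\<^sup>+x. 2 * ennreal ((cmod (f x))\<^sup>2) + 2 * ennreal ((cmod (g x))\<^sup>2) \<partial>lborel)"
    using norm_add_power2_le by (intro nn_integral_mono) (auto simp flip: ennreal_plus ennreal_mult'
        ennreal_numeral intro!: ennreal_leI)
  also have "\<dots> = 2 * (\<integral>\<^sup>+x. ennreal ((cmod (f x))\<^sup>2) \<partial>lborel) + 2 * (\<integral>\<^sup>+x. ennreal ((cmod (g x))\<^sup>2) \<partial>lborel)"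
    by (simp add: nn_integral_add nn_integral_cmult)
  finally show ?thesis .
qed

text \<open>The general weight lets one statement serve both plain square integrability (weight 1)
  and the Sobolev weight.\<close>

lemma integrable_weighted_cmod_add_sq:
  fixes f g :: "'a::euclidean_space \<Rightarrow> complex" and w :: "'a \<Rightarrow> real"
  assumes [measurable]: "f \<in> borel_measurable borel" "g \<in> borel_measurable borel"
      "w \<in> borel_measurable borel"
    and w: "\<And>x. 0 \<le> w x"
    and "integrable lborel (\<lambda>x. w x * (cmod (f x))\<^sup>2)" "integrable lborel (\<lambda>x. w x * (cmod (g x))\<^sup>2)"
  shows "integrable lborel (\<lambda>x. w x * (cmod (f x + g x))\<^sup>2)"
proof (rule Bochner_Integration.integrable_bound)
  show "integrable lborel (\<lambda>x. 2 * (w x * (cmod (f x))\<^sup>2) + 2 * (w x * (cmod (g x))\<^sup>2))"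
    using assms by auto
  show "AE x in lborel. norm (w x * (cmod (f x + g x))\<^sup>2)
      \<le> norm (2 * (w x * (cmod (f x))\<^sup>2) + 2 * (w x * (cmod (g x))\<^sup>2))"
  proof (rule AE_I2)
    fix x
    have "w x * (cmod (f x + g x))\<^sup>2 \<le> w x * (2 * (cmod (f x))\<^sup>2 + 2 * (cmod (g x))\<^sup>2)"
      using w by (intro mult_left_mono norm_add_power2_le)
    then show "norm (w x * (cmod (f x + g x))\<^sup>2)
      \<le> norm (2 * (w x * (cmod (f x))\<^sup>2) + 2 * (w x * (cmod (g x))\<^sup>2))"
      using w[of x] by (simp add: algebra_simps abs_mult)
  qed
qed simp

text \<open>The squared error of the sum is at most twice the sum of the squared errors, so it is
  squeezed to 0.\<close>

lemma is_L2_fourier_add: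
  fixes u v :: "'a::euclidean_space \<Rightarrow> real"
  assumes u: "is_L2_fourier u f" "continuous_on UNIV u"
    and v: "is_L2_fourier v g" "continuous_on UNIV v"
  shows "is_L2_fourier (\<lambda>x. u x + v x) (\<lambda>\<omega>. f \<omega> + g \<omega>)"
  unfolding is_L2_fourier_def
proof (intro conjI)
  have [measurable]: "f \<in> borel_measurable borel" "g \<in> borel_measurable borel"
    "u \<in> borel_measurable borel" "v \<in> borel_measurable borel"
    using u v by (auto simp: is_L2_fourier_def intro: borel_measurable_continuous_onI)
  show "(\<lambda>\<omega>. f \<omega> + g \<omega>) \<in> borel_measurable lborel" by simp
  show "integrable lborel (\<lambda>\<omega>. (cmod (f \<omega> + g \<omega>))\<^sup>2)"
    using integrable_weighted_cmod_add_sq[of f g "\<lambda>_. 1"] u v by (simp add: is_L2_fourier_def)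
  let ?E = "\<lambda>u g R. \<integral>\<^sup>+\<omega>. ennreal ((cmod (g \<omega> - truncated_fourier u R \<omega>))\<^sup>2) \<partial>lborel"
  have "((\<lambda>R. 2 * ?E u f R + 2 * ?E v g R) \<longlongrightarrow> 2 * 0 + 2 * 0) at_top"
    using u v by (intro tendsto_add ennreal_tendsto_cmult) (auto simp: is_L2_fourier_def)
  then have "((\<lambda>R. 2 * ?E u f R + 2 * ?E v g R) \<longlongrightarrow> 0) at_top" by simp
  moreover have "\<forall>\<^sub>F R in at_top. ?E (\<lambda>x. u x + v x) (\<lambda>\<omega>. f \<omega> + g \<omega>) R \<le> 2 * ?E u f R + 2 * ?E v g R"
  proof (intro always_eventually allI)
    fix R
    have "f \<omega> + g \<omega> - truncated_fourier (\<lambda>x. u x + v x) R \<omega> =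
        (f \<omega> - truncated_fourier u R \<omega>) + (g \<omega> - truncated_fourier v R \<omega>)" for \<omega>
      by (simp add: truncated_fourier_add u v)
    then show "?E (\<lambda>x. u x + v x) (\<lambda>\<omega>. f \<omega> + g \<omega>) R \<le> 2 * ?E u f R + 2 * ?E v g R"
      by (simp only:) (rule nn_integral_cmod_add_sq; measurable)
  qed
  ultimately show "(?E (\<lambda>x. u x + v x) (\<lambda>\<omega>. f \<omega> + g \<omega>) \<longlongrightarrow> 0) at_top"
    by (rule_tac tendsto_sandwich[OF _ _ tendsto_const]) simp_all
qed

lemma is_L2_fourier_cmult:
  assumes u: "is_L2_fourier u f" and [measurable]: "u \<in> borel_measurable borel"
  shows "is_L2_fourier (\<lambda>x. c * u x) (\<lambda>\<omega>. of_real c * f \<omega>)"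
proof -
  have [measurable]: "f \<in> borel_measurable borel" using u by (auto simp: is_L2_fourier_def)
  have "(cmod (of_real c * f \<omega> - of_real c * z))\<^sup>2 = c\<^sup>2 * (cmod (f \<omega> - z))\<^sup>2" for \<omega> z
    by (simp flip: right_diff_distrib add: norm_mult power_mult_distrib)
  then have eq: "(\<integral>\<^sup>+\<omega>. ennreal ((cmod (of_real c * f \<omega> - of_real c * truncated_fourier u R \<omega>))\<^sup>2) \<partial>lborel)
     = ennreal (c\<^sup>2) * (\<integral>\<^sup>+\<omega>. ennreal ((cmod (f \<omega> - truncated_fourier u R \<omega>))\<^sup>2) \<partial>lborel)" for R
    by (simp add: ennreal_mult' nn_integral_cmult)
  have "((\<lambda>R. ennreal (c\<^sup>2) * (\<integral>\<^sup>+\<omega>. ennreal ((cmod (f \<omega> - truncated_fourier u R \<omega>))\<^sup>2) \<partial>lborel))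
      \<longlongrightarrow> ennreal (c\<^sup>2) * 0) at_top"
    using u by (intro ennreal_tendsto_cmult) (simp_all add: is_L2_fourier_def)
  then show ?thesis
    using u by (simp add: is_L2_fourier_def truncated_fourier_cmult eq norm_mult power_mult_distrib)
qed

text \<open>The squared error at radius \<open>R\<close> is \<open>h ^ DIM('a)\<close> times the
  error of \<open>u\<close> at radius \<open>R / h\<close>: squaring gives this factor twice and the
  change of variables removes one. With \<open>R\<close> also \<open>R / h\<close> tends to
  infinity.\<close>

lemma is_L2_fourier_dilate:
  fixes u :: "'a::euclidean_space \<Rightarrow> real"
  assumes u: "is_L2_fourier u f" and h: "h > 0" and [measurable]: "u \<in> borel_measurable borel"
  shows "is_L2_fourier (\<lambda>x. u (x /\<^sub>R h)) (\<lambda>\<omega>. of_real (h ^ DIM('a)) * f (h *\<^sub>R \<omega>))"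
  unfolding is_L2_fourier_def
proof (intro conjI)
  have [measurable]: "f \<in> borel_measurable borel" using u by (auto simp: is_L2_fourier_def)
  show "(\<lambda>\<omega>. of_real (h ^ DIM('a)) * f (h *\<^sub>R \<omega>)) \<in> borel_measurable lborel" by simp
  show "integrable lborel (\<lambda>\<omega>. (cmod (of_real (h ^ DIM('a)) * f (h *\<^sub>R \<omega>)))\<^sup>2)"
    using u integrable_lborel_scaleR[of "\<lambda>\<omega>. (cmod (f \<omega>))\<^sup>2" h] h
    by (simp add: is_L2_fourier_def norm_mult power_mult_distrib)
  let ?E = "\<lambda>R. \<integral>\<^sup>+\<omega>. ennreal ((cmod (f \<omega> - truncated_fourier u R \<omega>))\<^sup>2) \<partial>lborel"
  let ?d = "h ^ DIM('a)"
  have "(cmod (of_real ?d * y - of_real ?d * z))\<^sup>2 = ?d\<^sup>2 * (cmod (y - z))\<^sup>2" for y z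
    using h by (simp flip: right_diff_distrib add: norm_mult norm_power power_mult_distrib)
  then have "(\<integral>\<^sup>+\<omega>. ennreal ((cmod (of_real ?d * f (h *\<^sub>R \<omega>) -
      truncated_fourier (\<lambda>x. u (x /\<^sub>R h)) R \<omega>))\<^sup>2) \<partial>lborel) = ennreal ?d * ?E (R / h)" for R
    using h by (subst nn_integral_lborel_scaleR[OF _ h])
      (simp_all add: truncated_fourier_dilate ennreal_mult' nn_integral_cmult power2_eq_square mult.assoc)
  moreover have "((\<lambda>R. ennreal ?d * ?E (R / h)) \<longlongrightarrow> ennreal ?d * 0) at_top"
  proof (intro ennreal_tendsto_cmult)
    have "LIM R at_top. R / h :> at_top" using h by real_asymp
    then show "((\<lambda>R. ?E (R / h)) \<longlongrightarrow> 0) at_top"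
      using u by (auto simp: is_L2_fourier_def intro: filterlim_compose[rotated])
  qed simp
  ultimately show "((\<lambda>R. \<integral>\<^sup>+\<omega>. ennreal ((cmod (of_real ?d * f (h *\<^sub>R \<omega>) -
      truncated_fourier (\<lambda>x. u (x /\<^sub>R h)) R \<omega>))\<^sup>2) \<partial>lborel) \<longlongrightarrow> 0) at_top"
    by simp
qed

text \<open>For every \<open>R\<close> the squared distance of \<open>f\<close> and \<open>g\<close>
  is at most twice the sum of their errors at \<open>R\<close>; the limit in \<open>R\<close> makes
  it 0.\<close>

lemma is_L2_fourier_unique:
  assumes f: "is_L2_fourier u f" and g: "is_L2_fourier u g" and [measurable]: "u \<in> borel_measurable borel"
  shows "AE \<omega> in lborel. f \<omega> = g \<omega>"
proof -
  have [measurable]: "f \<in> borel_measurable borel" "g \<in> borel_measurable borel"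
    using f g by (auto simp: is_L2_fourier_def)
  let ?E = "\<lambda>g R. \<integral>\<^sup>+\<omega>. ennreal ((cmod (g \<omega> - truncated_fourier u R \<omega>))\<^sup>2) \<partial>lborel"
  let ?D = "\<integral>\<^sup>+\<omega>. ennreal ((cmod (f \<omega> - g \<omega>))\<^sup>2) \<partial>lborel"
  have "?D \<le> 2 * ?E f R + 2 * ?E g R" for R
    using nn_integral_cmod_add_sq[of "\<lambda>\<omega>. f \<omega> - truncated_fourier u R \<omega>" "\<lambda>\<omega>. truncated_fourier u R \<omega> - g \<omega>"]
    by (simp add: norm_minus_commute)
  moreover have "((\<lambda>R. 2 * ?E f R + 2 * ?E g R) \<longlongrightarrow> 2 * 0 + 2 * 0) at_top"
    using f g by (intro tendsto_add ennreal_tendsto_cmult) (auto simp: is_L2_fourier_def)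
  ultimately have "?D \<le> 2 * 0 + 2 * 0"
    by (intro tendsto_lowerbound[where F = at_top]) auto
  then have "AE \<omega> in lborel. ennreal ((cmod (f \<omega> - g \<omega>))\<^sup>2) = 0"
    by (subst nn_integral_0_iff_AE[symmetric]) auto
  then show ?thesis by eventually_elim (auto simp: ennreal_eq_0_iff)
qed

section \<open>The Sobolev space as a vector space, and its norm under dilation\<close>

text \<open>\<open>L2_fourier\<close> is a Hilbert choice. By uniqueness almost everywhere, any
  explicit transform may replace it when the norm is computed.\<close>

lemma sobolev_norm_eq:
  assumes g: "is_L2_fourier u g" and [measurable]: "u \<in> borel_measurable borel"
  shows "sobolev_norm m u = sqrt (LINT \<omega>|lborel. (1 + (norm \<omega>)\<^sup>2) powr m * (cmod (g \<omega>))\<^sup>2)"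
proof -
  have *: "is_L2_fourier u (L2_fourier u)"
    unfolding L2_fourier_def using someI[of "is_L2_fourier u", OF g] .
  have [measurable]: "L2_fourier u \<in> borel_measurable borel" "g \<in> borel_measurable borel"
    using * g by (auto simp: is_L2_fourier_def)
  have "AE \<omega> in lborel. L2_fourier u \<omega> = g \<omega>"
    using is_L2_fourier_unique[OF * g] by simp
  then show ?thesis
    unfolding sobolev_norm_def by (intro arg_cong[where f = sqrt] integral_cong_AE) (auto elim: eventually_mono)
qed

lemma sobolev_space_borel_measurable: "u \<in> sobolev_space m \<Longrightarrow> u \<in> borel_measurable borel"
  by (auto simp: sobolev_space_def intro: borel_measurable_continuous_onI)

lemma sobolev_space_add:
  assumes "u \<in> sobolev_space m" "v \<in> sobolev_space m"
  shows "(\<lambda>x. u x + v x) \<in> sobolev_space m"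
proof -
  obtain f g where f: "is_L2_fourier u f" "integrable lborel (\<lambda>\<omega>. (1 + (norm \<omega>)\<^sup>2) powr m * (cmod (f \<omega>))\<^sup>2)"
    and g: "is_L2_fourier v g" "integrable lborel (\<lambda>\<omega>. (1 + (norm \<omega>)\<^sup>2) powr m * (cmod (g \<omega>))\<^sup>2)"
    using assms by (auto simp: sobolev_space_def)
  have c: "continuous_on UNIV u" "continuous_on UNIV v"
    and i: "integrable lborel (\<lambda>x. (u x)\<^sup>2)" "integrable lborel (\<lambda>x. (v x)\<^sup>2)"
    using assms by (auto simp: sobolev_space_def)
  note [measurable] = assms[THEN sobolev_space_borel_measurable]
  have [measurable]: "f \<in> borel_measurable borel" "g \<in> borel_measurable borel"
    using f g by (auto simp: is_L2_fourier_def)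
  \<comment> \<open>The estimate for sums is about complex functions, so the real ones are embedded,
    with weight 1.\<close>
  have "integrable lborel (\<lambda>x. 1 * (cmod (of_real (u x) + of_real (v x)))\<^sup>2)"
    using i by (intro integrable_weighted_cmod_add_sq) auto
  then have "integrable lborel (\<lambda>x. (u x + v x)\<^sup>2)"
    by (simp flip: of_real_add)
  moreover have "integrable lborel (\<lambda>\<omega>. (1 + (norm \<omega>)\<^sup>2) powr m * (cmod (f \<omega> + g \<omega>))\<^sup>2)"
    using f g by (intro integrable_weighted_cmod_add_sq) auto
  ultimately show ?thesis
    unfolding sobolev_space_def
    using is_L2_fourier_add[OF f(1) c(1) g(1) c(2)] c
    by (auto intro!: continuous_intros)
qed

lemma sobolev_space_cmult:
  assumes "u \<in> sobolev_space m"
  shows "(\<lambda>x. c * u x) \<in> sobolev_space m"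
proof -
  obtain f where f: "is_L2_fourier u f" "integrable lborel (\<lambda>\<omega>. (1 + (norm \<omega>)\<^sup>2) powr m * (cmod (f \<omega>))\<^sup>2)"
    using assms by (auto simp: sobolev_space_def)
  show ?thesis
    using assms f is_L2_fourier_cmult[OF f(1) sobolev_space_borel_measurable[OF assms], of c]
    unfolding sobolev_space_def 
    by (auto intro!: continuous_intros exI[of _ "\<lambda>\<omega>. of_real c * f \<omega>"]
        simp: norm_mult power_mult_distrib mult.left_commute[of _ "c\<^sup>2"])
qed

lemma sobolev_space_sum:
  assumes "finite A" "A \<noteq> {}" "\<And>i. i \<in> A \<Longrightarrow> f i \<in> sobolev_space m"
  shows "(\<lambda>x. \<Sum>i\<in>A. f i x) \<in> sobolev_space m"
  using assms by (induction A rule: finite_ne_induct) (auto intro: sobolev_space_add)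

lemma sobolev_norm_cmult:
  assumes "u \<in> sobolev_space m"
  shows "sobolev_norm m (\<lambda>x. c * u x) = \<bar>c\<bar> * sobolev_norm m u"
proof -
  obtain f where f: "is_L2_fourier u f"
    using assms by (auto simp: sobolev_space_def)
  note m = sobolev_space_borel_measurable[OF assms]
  show ?thesis
    using m by (subst sobolev_norm_eq[OF is_L2_fourier_cmult[OF f m]])
      (auto simp: sobolev_norm_eq[OF f m] real_sqrt_mult norm_mult power_mult_distrib mult.left_commute[of _ "c\<^sup>2"])
qed

text \<open>For \<open>h \<le> 1\<close> one has \<open>h\<^sup>2 * (1 + (norm \<omega>)\<^sup>2)
  \<le> 1 + (norm (h *\<^sub>R \<omega>))\<^sup>2\<close>; raising this to the power
  \<open>m\<close> gives the claim.\<close>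

lemma weight_dilate_le:
  fixes \<omega> :: "'a::real_normed_vector"
  assumes "0 < h" "h \<le> 1" "0 \<le> m"
  shows "(1 + (norm \<omega>)\<^sup>2) powr m \<le> h powr (-2 * m) * (1 + (norm (h *\<^sub>R \<omega>))\<^sup>2) powr m"
proof -
  have "h\<^sup>2 * (1 + (norm \<omega>)\<^sup>2) \<le> 1 + (norm (h *\<^sub>R \<omega>))\<^sup>2"
    using assms by (simp add: power_mult_distrib distrib_left power_le_one)
  then have "(h\<^sup>2 * (1 + (norm \<omega>)\<^sup>2)) powr m \<le> (1 + (norm (h *\<^sub>R \<omega>))\<^sup>2) powr m"
    using assms by (intro powr_mono2) auto
  moreover have "(h\<^sup>2 * (1 + (norm \<omega>)\<^sup>2)) powr m = h powr (2 * m) * (1 + (norm \<omega>)\<^sup>2) powr m"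
    using assms by (simp add: powr_mult powr_powr flip: powr_numeral)
  ultimately show ?thesis
    using assms by (simp add: powr_minus field_simps)
qed

text \<open>The transform of the contracted function is \<open>h ^ DIM('a)\<close> times the dilated
  transform. The weight costs \<open>h powr (-2 * m)\<close>, the square gives
  \<open>h ^ DIM('a)\<close> twice and the change of variables takes one back; the square root
  leaves the exponent \<open>d/2 - m\<close>.\<close>

lemma
  fixes u :: "'a::euclidean_space \<Rightarrow> real"
  assumes u: "u \<in> sobolev_space m" and h: "0 < h" "h \<le> 1" and m: "0 \<le> m"
  shows sobolev_space_dilate: "(\<lambda>x. u (x /\<^sub>R h)) \<in> sobolev_space m"
    and sobolev_norm_dilate_le:
      "sobolev_norm m (\<lambda>x. u (x /\<^sub>R h)) \<le> h powr (real DIM('a) / 2 - m) * sobolev_norm m u"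
proof -
  obtain f where f: "is_L2_fourier u f" "integrable lborel (\<lambda>\<omega>. (1 + (norm \<omega>)\<^sup>2) powr m * (cmod (f \<omega>))\<^sup>2)"
    using u by (auto simp: sobolev_space_def)
  note [measurable] = sobolev_space_borel_measurable[OF u]
  have [measurable]: "f \<in> borel_measurable borel" using f by (auto simp: is_L2_fourier_def)
  let ?d = "h ^ DIM('a)" and ?v = "\<lambda>x. u (x /\<^sub>R h)"
  let ?g = "\<lambda>\<omega>. of_real ?d * f (h *\<^sub>R \<omega>)" and ?F = "\<lambda>\<omega>. (1 + (norm \<omega>)\<^sup>2) powr m * (cmod (f \<omega>))\<^sup>2"
  let ?c = "h powr (-2 * m) * ?d\<^sup>2"
  have g: "is_L2_fourier ?v ?g" using is_L2_fourier_dilate[OF f(1) h(1)] by simp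
  have le: "(1 + (norm \<omega>)\<^sup>2) powr m * (cmod (?g \<omega>))\<^sup>2 \<le> ?c * ?F (h *\<^sub>R \<omega>)" for \<omega>
    using mult_right_mono[OF weight_dilate_le[OF h m, of \<omega>], of "(cmod (?g \<omega>))\<^sup>2"] h
    by (simp add: norm_mult norm_power power_mult_distrib mult_ac)
  have iF: "integrable lborel (\<lambda>\<omega>. ?F (h *\<^sub>R \<omega>))"
    by (rule integrable_lborel_scaleR[OF f(2) h(1)])
  then have ic: "integrable lborel (\<lambda>\<omega>. ?c * ?F (h *\<^sub>R \<omega>))" by simp
  then have ig: "integrable lborel (\<lambda>\<omega>. (1 + (norm \<omega>)\<^sup>2) powr m * (cmod (?g \<omega>))\<^sup>2)"
    using le by (rule_tac Bochner_Integration.integrable_bound[OF ic]) (auto intro!: AE_I2 order_trans[OF _ abs_ge_self])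
  have "continuous_on UNIV u" using u by (simp add: sobolev_space_def)
  then have "continuous_on UNIV ?v"
    by (rule continuous_on_compose2) (auto intro!: continuous_intros)
  moreover have "integrable lborel (\<lambda>x. (u x)\<^sup>2)" using u by (simp add: sobolev_space_def)
  then have "integrable lborel (\<lambda>x. (?v x)\<^sup>2)"
    using integrable_lborel_scaleR[of "\<lambda>x. (u x)\<^sup>2" "inverse h"] h by simp
  ultimately show "?v \<in> sobolev_space m"
    using g ig by (auto simp: sobolev_space_def)
  have "(LINT \<omega>|lborel. (1 + (norm \<omega>)\<^sup>2) powr m * (cmod (?g \<omega>))\<^sup>2) \<le> (LINT \<omega>|lborel. ?c * ?F (h *\<^sub>R \<omega>))"
    using ig ic le by (rule integral_mono)
  also have "\<dots> = ?c * (LINT \<omega>|lborel. ?F (h *\<^sub>R \<omega>))" by simp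
  also have "\<dots> = h powr (-2 * m) * ?d * (LINT \<omega>|lborel. ?F \<omega>)"
    using integral_lborel_scaleR[OF h(1), of ?F] by (simp add: power2_eq_square)
  also have "h powr (-2 * m) * ?d = (h powr (real DIM('a) / 2 - m))\<^sup>2"
    using h by (simp add: power2_eq_square flip: powr_realpow powr_add)
  finally have "sqrt (LINT \<omega>|lborel. (1 + (norm \<omega>)\<^sup>2) powr m * (cmod (?g \<omega>))\<^sup>2)
      \<le> sqrt ((h powr (real DIM('a) / 2 - m))\<^sup>2 * (LINT \<omega>|lborel. ?F \<omega>))"
    by (rule real_sqrt_le_mono)
  then show "sobolev_norm m ?v \<le> h powr (real DIM('a) / 2 - m) * sobolev_norm m u"
    by (simp add: sobolev_norm_eq[OF g] sobolev_norm_eq[OF f(1)] real_sqrt_mult)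
qed

section \<open>Compactly supported functions in the Sobolev space\<close>

text \<open>The unnormalized transform of a polynomial cut off to an interval. Polynomials are
  closed under \<open>pderiv\<close>, and divisibility records the order of vanishing at the
  endpoints.\<close>

definition fourier_poly :: "real \<Rightarrow> real \<Rightarrow> real poly \<Rightarrow> real \<Rightarrow> complex" where
  "fourier_poly a b p \<omega> = (LINT x:{a..b}|lborel. of_real (poly p x) * cis (- (x * \<omega>)))"

lemma fourier_poly_integrable:
  "set_integrable lborel {a..b} (\<lambda>x. of_real (poly p x) * cis (- (x * \<omega>)))"
  by (intro borel_integrable_atLeastAtMost' continuous_intros)

text \<open>Integration by parts, obtained from the fundamental theorem for \<open>poly p x\<close>
  times the exponential; the zeros at \<open>a\<close> and \<open>b\<close> remove the boundary
  terms.\<close>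

lemma fourier_poly_pderiv:
  assumes "a \<le> b" "poly p a = 0" "poly p b = 0"
  shows "\<i> * of_real \<omega> * fourier_poly a b p \<omega> = fourier_poly a b (pderiv p) \<omega>"
proof -
  let ?F = "\<lambda>x. of_real (poly p x) * cis (- (x * \<omega>)) :: complex"
  let ?f = "\<lambda>x. of_real (poly (pderiv p) x) * cis (- (x * \<omega>)) - \<i> * of_real \<omega> * ?F x"
  have "(?F has_vector_derivative ?f x) (at x within {a..b})" for x
  proof -
    have "((\<lambda>x. cis (- (x * \<omega>))) has_vector_derivative (- \<omega>) *\<^sub>R (\<i> * cis (- (x * \<omega>)))) (at x within {a..b})"
      unfolding has_vector_derivative_def
      by (rule derivative_eq_intros refl | simp add: scaleR_conv_of_real mult_ac)+
    moreover have "((\<lambda>x. complex_of_real (poly p x)) has_vector_derivative of_real (poly (pderiv p) x)) (at x within {a..b})"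
      by (intro has_vector_derivative_of_real) (use poly_DERIV DERIV_subset in blast)
    ultimately show ?thesis
      by (rule has_vector_derivative_eq_rhs[OF has_vector_derivative_mult[rotated]])
         (simp add: scaleR_conv_of_real algebra_simps)
  qed
  then have "(LINT x:{a..b}|lborel. ?f x) = ?F b - ?F a"
    unfolding set_lebesgue_integral_def
    by (intro integral_FTC_atLeastAtMost continuous_intros assms)
  also have "\<dots> = 0" using assms by simp
  also have "(LINT x:{a..b}|lborel. ?f x) = fourier_poly a b (pderiv p) \<omega> - \<i> * of_real \<omega> * fourier_poly a b p \<omega>"
    unfolding fourier_poly_def set_integral_mult_right[symmetric]
    by (intro set_integral_diff set_integrable_mult_right fourier_poly_integrable)
  finally show ?thesis by simp
qed

text \<open>Each integration by parts gains a factor \<open>\<bar>\<omega>\<bar>\<close> and costs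
  one power of \<open>r\<close> in the divisor; as long as such a power remains, the boundary terms
  vanish.\<close>

lemma fourier_poly_decay:
  assumes "a \<le> b" "r ^ n dvd p" "poly r a = 0" "poly r b = 0"
  shows "\<exists>C. \<forall>\<omega>. \<bar>\<omega>\<bar> ^ n * cmod (fourier_poly a b p \<omega>) \<le> C"
  using assms(2)
proof (induction n arbitrary: p)
  case 0
  \<comment> \<open>Without any integration by parts, the L1 norm of the cut-off polynomial is a
    bound.\<close>
  have "cmod (fourier_poly a b p \<omega>) \<le> (LINT x:{a..b}|lborel. \<bar>poly p x\<bar>)" for \<omega>
    unfolding fourier_poly_def
    using set_integral_norm_bound[OF fourier_poly_integrable[of a b p \<omega>]] by (simp add: norm_mult)
  then show ?case by auto
next
  case (Suc n)
  obtain q where p: "p = r ^ Suc n * q" using Suc.prems by (auto elim: dvdE)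
  have "pderiv p = r ^ n * (smult (of_nat (Suc n)) (pderiv r * q) + r * pderiv q)"
    unfolding p pderiv_mult pderiv_power_Suc by (simp add: algebra_simps)
  then obtain C where C: "\<And>\<omega>. \<bar>\<omega>\<bar> ^ n * cmod (fourier_poly a b (pderiv p) \<omega>) \<le> C"
    using Suc.IH[of "pderiv p"] by auto
  have "\<bar>\<omega>\<bar> * cmod (fourier_poly a b p \<omega>) = cmod (fourier_poly a b (pderiv p) \<omega>)" for \<omega>
    using fourier_poly_pderiv[of a b p \<omega>] assms
    by (metis p mult_zero_left norm_ii norm_mult norm_of_real poly_mult poly_power power_Suc mult_1)
  then have "\<bar>\<omega>\<bar> ^ Suc n * cmod (fourier_poly a b p \<omega>) \<le> C" for \<omega>
    using C[of \<omega>] by (simp add: power_Suc2 mult.assoc del: power_Suc)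
  then show ?case by blast
qed

text \<open>A truncated parabola raised to the power \<open>n\<close>. On the interval of radius
  \<open>\<delta>\<close> around \<open>c\<close> it is a polynomial vanishing to order
  \<open>n\<close> at both endpoints when \<open>\<delta> > 0\<close>, so \<open>n\<close> controls
  the decay of the transform.\<close>

definition bump :: "real \<Rightarrow> nat \<Rightarrow> real \<Rightarrow> real \<Rightarrow> real" where
  "bump \<delta> n c x = max 0 (\<delta>\<^sup>2 - (x - c)\<^sup>2) ^ n"

lemma continuous_on_bump [continuous_intros]: "continuous_on A (bump \<delta> n c)"
  unfolding bump_def[abs_def] by (intro continuous_intros)

lemma bump_center: "bump \<delta> n c c = \<delta> ^ (2 * n)"
  by (simp add: bump_def power_mult)

lemma bump_eq_0: "bump \<delta> n c x = 0" if "\<delta> \<le> \<bar>x - c\<bar>" "0 \<le> \<delta>" "n > 0"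
  using power_mono[of \<delta> "\<bar>x - c\<bar>" 2] that by (simp add: bump_def max_def)

lemma power_one_plus_square_le: "(1 + x\<^sup>2) ^ N \<le> 2 ^ N * (1 + \<bar>x\<bar> ^ (2 * N))" for x :: real
proof -
  have "(1 + x\<^sup>2) ^ N \<le> (2 * max 1 (x\<^sup>2)) ^ N" by (intro power_mono) auto
  also have "\<dots> = 2 ^ N * max 1 (x\<^sup>2) ^ N" by (simp add: power_mult_distrib)
  also have "max 1 (x\<^sup>2) ^ N \<le> 1 + \<bar>x\<bar> ^ (2 * N)"
    by (simp add: max_def power_mult)
  finally show ?thesis by simp
qed

text \<open>The power \<open>2 * N\<close> permits \<open>2 * N\<close> integrations by parts,
  matching the degree of \<open>(1 + \<omega>\<^sup>2) ^ N\<close> in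
  \<open>\<omega>\<close>.\<close>

lemma fourier_bump_decay:
  assumes \<delta>: "\<delta> \<ge> 0" and N: "N > 0"
  shows "\<exists>C. \<forall>\<omega>. cmod (LINT x|lborel. of_real (bump \<delta> (2 * N) c x) * cis (- (x * \<omega>)))
      * (1 + \<omega>\<^sup>2) ^ N \<le> C"
proof -
  \<comment> \<open>The coefficients of \<open>\<delta>\<^sup>2 - (x - c)\<^sup>2\<close>, which
    vanishes at \<open>c - \<delta>\<close> and \<open>c + \<delta>\<close>.\<close>
  define r where "r = [:\<delta>\<^sup>2 - c\<^sup>2, 2 * c, -1:]"
  have r: "poly r x = \<delta>\<^sup>2 - (x - c)\<^sup>2" for x
    by (simp add: r_def power2_eq_square algebra_simps)
  let ?a = "c - \<delta>" and ?b = "c + \<delta>"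
  have eq: "bump \<delta> (2 * N) c x = indicator {?a..?b} x * poly (r ^ (2 * N)) x" for x
  proof (cases "x \<in> {?a..?b}")
    case True
    then have "(x - c)\<^sup>2 \<le> \<delta>\<^sup>2" by (intro abs_le_square_iff[THEN iffD1]) auto
    with True show ?thesis by (simp add: bump_def poly_power r)
  next
    case False
    then have "\<delta> \<le> \<bar>x - c\<bar>" by auto
    with False show ?thesis using N \<delta> by (simp add: bump_eq_0)
  qed
  have F: "(LINT x|lborel. of_real (bump \<delta> (2 * N) c x) * cis (- (x * \<omega>)))
      = fourier_poly ?a ?b (r ^ (2 * N)) \<omega>" for \<omega>
    unfolding fourier_poly_def set_lebesgue_integral_def
    by (intro Bochner_Integration.integral_cong) (simp_all add: eq scaleR_conv_of_real mult.assoc)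
  have ab: "?a \<le> ?b" "poly r ?a = 0" "poly r ?b = 0" using \<delta> by (simp_all add: r)
  obtain C where C: "\<And>\<omega>. \<bar>\<omega>\<bar> ^ (2 * N) * cmod (fourier_poly ?a ?b (r ^ (2 * N)) \<omega>) \<le> C"
    using fourier_poly_decay[of ?a ?b r "2 * N" "r ^ (2 * N)"] ab by auto
  \<comment> \<open>The bound of order 0 covers the summand 1 in
    \<open>1 + \<bar>\<omega>\<bar> ^ (2 * N)\<close>; the bound \<open>C\<close> covers the other
    one.\<close>
  obtain D where D: "\<And>\<omega>. cmod (fourier_poly ?a ?b (r ^ (2 * N)) \<omega>) \<le> D"
    using fourier_poly_decay[of ?a ?b r 0 "r ^ (2 * N)"] ab by auto
  have "cmod (fourier_poly ?a ?b (r ^ (2 * N)) \<omega>) * (1 + \<omega>\<^sup>2) ^ N \<le> 2 ^ N * (D + C)" for \<omega>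
  proof -
    let ?J = "cmod (fourier_poly ?a ?b (r ^ (2 * N)) \<omega>)"
    have "?J * (1 + \<omega>\<^sup>2) ^ N \<le> ?J * (2 ^ N * (1 + \<bar>\<omega>\<bar> ^ (2 * N)))"
      by (intro mult_left_mono power_one_plus_square_le) auto
    also have "\<dots> = 2 ^ N * (?J + \<bar>\<omega>\<bar> ^ (2 * N) * ?J)"
      by (simp only: distrib_left distrib_right mult_1_right mult_ac)
    also have "\<dots> \<le> 2 ^ N * (D + C)"
      using C[of \<omega>] D[of \<omega>] by (intro mult_left_mono add_mono) auto
    finally show ?thesis .
  qed
  then show ?thesis unfolding F by blast
qed

section \<open>Tensor products in the Sobolev space and separation of points\<close>

lemma one_plus_sum_le_prod:
  fixes f :: "'b \<Rightarrow> real"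
  assumes "finite A" "\<And>i. i \<in> A \<Longrightarrow> 0 \<le> f i"
  shows "1 + (\<Sum>i\<in>A. f i) \<le> (\<Prod>i\<in>A. 1 + f i)"
  using assms
proof (induction A rule: finite_induct)
  case (insert x A)
  then have "0 \<le> (\<Sum>i\<in>A. f i)" by (intro sum_nonneg) auto
  with insert have "1 + (\<Sum>i\<in>insert x A. f i) \<le> (1 + f x) * (1 + (\<Sum>i\<in>A. f i))"
    by (simp add: algebra_simps)
  also have "\<dots> \<le> (1 + f x) * (\<Prod>i\<in>A. 1 + f i)"
    using insert by (intro mult_left_mono) auto
  finally show ?case using insert by simp
qed simp

text \<open>Bounds the radial weight by a tensor product, so that weighted integrals of tensor
  products reduce to one dimension.\<close>

lemma weight_le_prod:
  fixes \<omega> :: "'a::euclidean_space"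
  assumes "0 \<le> m"
  shows "(1 + (norm \<omega>)\<^sup>2) powr m \<le> (\<Prod>b\<in>Basis. (1 + (\<omega> \<bullet> b)\<^sup>2) powr m)"
proof -
  have "1 + (norm \<omega>)\<^sup>2 = 1 + (\<Sum>b\<in>Basis. (\<omega> \<bullet> b)\<^sup>2)"
    unfolding power2_norm_eq_inner by (subst euclidean_inner) (simp add: power2_eq_square)
  also have "\<dots> \<le> (\<Prod>b\<in>Basis. 1 + (\<omega> \<bullet> b)\<^sup>2)" by (intro one_plus_sum_le_prod) auto
  finally have "(1 + (norm \<omega>)\<^sup>2) powr m \<le> (\<Prod>b\<in>Basis. 1 + (\<omega> \<bullet> b)\<^sup>2) powr m"
    using assms by (intro powr_mono2) auto
  then show ?thesis by (simp add: prod_powr_distrib)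
qed

lemma integrable_inverse_1_plus_square_lborel:
  "integrable lborel (\<lambda>x::real. inverse (1 + x\<^sup>2))"
  using integrable_inverse_1_plus_square by (simp add: set_integrable_def)

lemma integrable_compact_support:
  fixes f :: "'a::euclidean_space \<Rightarrow> 'b::{banach, second_countable_topology}"
  assumes "continuous_on UNIV f" "compact K" "\<And>x. x \<notin> K \<Longrightarrow> f x = 0"
  shows "integrable lborel f"
proof -
  have "integrable lborel (\<lambda>x. indicator K x *\<^sub>R f x)"
    using assms(1,2) by (intro borel_integrable_compact) (auto intro: continuous_on_subset)
  moreover have "(\<lambda>x. indicator K x *\<^sub>R f x) = f"
    using assms(3) by (auto simp: fun_eq_iff indicator_def)
  ultimately show ?thesis by simp
qed

lemma truncated_fourier_compact_support:
  fixes u :: "'a::euclidean_space \<Rightarrow> real"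
  assumes K: "\<And>x. norm x > K \<Longrightarrow> u x = 0" and R: "R \<ge> K"
  shows "truncated_fourier u R \<omega> = of_real ((2 * pi) powr (- (real DIM('a) / 2))) *
    (LINT x|lborel. of_real (u x) * cis (- (x \<bullet> \<omega>)))"
proof -
  have "indicator (cball 0 R) x *\<^sub>R (complex_of_real (u x) * cis (- (x \<bullet> \<omega>)))
      = of_real (u x) * cis (- (x \<bullet> \<omega>))" for x
    using K[of x] R by (auto simp: indicator_def)
  then show ?thesis
    by (simp add: truncated_fourier_def set_lebesgue_integral_def)
qed

text \<open>From radius \<open>K\<close> on the truncated transforms coincide, so the error is
  eventually 0 and only square integrability remains to be assumed.\<close>

lemma is_L2_fourier_compact_support:
  fixes u :: "'a::euclidean_space \<Rightarrow> real"
  assumes u: "continuous_on UNIV u" and K: "\<And>x. norm x > K \<Longrightarrow> u x = 0"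
    and int: "integrable lborel (\<lambda>\<omega>. (cmod (truncated_fourier u K \<omega>))\<^sup>2)"
  shows "is_L2_fourier u (truncated_fourier u K)"
proof -
  have eq: "truncated_fourier u R = truncated_fourier u K" if "R \<ge> K" for R
    using that by (intro ext) (simp add: truncated_fourier_compact_support[of K u, OF K])
  have "u \<in> borel_measurable borel" using u by (rule borel_measurable_continuous_onI)
  then have "truncated_fourier u K \<in> borel_measurable lborel" by simp
  moreover have "((\<lambda>R. \<integral>\<^sup>+ \<omega>. ennreal ((cmod (truncated_fourier u K \<omega> - truncated_fourier u R \<omega>))\<^sup>2) \<partial>lborel) \<longlongrightarrow> 0) at_top"
  proof (rule tendsto_eventually, rule eventually_mono[OF eventually_ge_at_top[of K]])
    fix R assume "K \<le> R"
    from eq[OF this] show "(\<integral>\<^sup>+ \<omega>. ennreal ((cmod (truncated_fourier u K \<omega> - truncated_fourier u R \<omega>))\<^sup>2) \<partial>lborel) = 0"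
      by simp
  qed
  ultimately show ?thesis using int by (simp add: is_L2_fourier_def)
qed

lemma cis_sum: "finite A \<Longrightarrow> cis (\<Sum>i\<in>A. f i) = (\<Prod>i\<in>A. cis (f i))"
  by (induction A rule: finite_induct) (auto simp: cis_mult[symmetric])

text \<open>The transform factors over the coordinates, and the weight is bounded by a product. In
  each coordinate, \<open>m + 1 \<le> 2 * real N\<close> leaves a multiple of
  \<open>inverse (1 + t\<^sup>2)\<close>, which is integrable.\<close>

lemma tensor_sobolev:
  fixes f :: "'a::euclidean_space \<Rightarrow> real \<Rightarrow> real"
  assumes m: "m \<ge> 0" and N: "m + 1 \<le> 2 * real N"
    and cont: "\<And>b. b \<in> Basis \<Longrightarrow> continuous_on UNIV (f b)"
    and supp: "\<And>b x. b \<in> Basis \<Longrightarrow> K < \<bar>x\<bar> \<Longrightarrow> f b x = 0"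
    and decay: "\<And>b. b \<in> Basis \<Longrightarrow>
       \<exists>C. \<forall>\<omega>. cmod (LINT x|lborel. of_real (f b x) * cis (- (x * \<omega>))) * (1 + \<omega>\<^sup>2) ^ N \<le> C"
  shows "(\<lambda>x. \<Prod>b\<in>Basis. f b (x \<bullet> b)) \<in> sobolev_space m"
proof -
  let ?u = "\<lambda>x. \<Prod>b\<in>Basis. f b (x \<bullet> b)"
  define F where "F b \<omega> = (LINT x|lborel. of_real (f b x) * cis (- (x * \<omega>)))" for b \<omega>
  let ?c = "complex_of_real ((2 * pi) powr (- (real DIM('a) / 2)))"
  define g where "g = truncated_fourier ?u (real DIM('a) * K)"
  let ?w = "\<lambda>\<omega>::'a. (1 + (norm \<omega>)\<^sup>2) powr m"

  have u_cont: "continuous_on UNIV ?u"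
    by (intro continuous_intros continuous_on_compose2[OF cont]) auto
  \<comment> \<open>If all coordinates were at most \<open>K\<close> in absolute value, the l1 norm,
    and with it the Euclidean norm, would be at most \<open>real DIM('a) * K\<close>.\<close>
  have u_supp: "?u x = 0" if "norm x > real DIM('a) * K" for x
  proof -
    have "\<exists>b\<in>Basis. K < \<bar>x \<bullet> b\<bar>"
    proof (rule ccontr)
      assume "\<not> ?thesis"
      then have "(\<Sum>b\<in>Basis. \<bar>x \<bullet> b\<bar>) \<le> real DIM('a) * K"
        by (intro sum_bounded_above) auto
      with norm_le_l1[of x] that show False by simp
    qed
    then show ?thesis using supp by auto
  qed
  have u_sq: "integrable lborel (\<lambda>x. (?u x)\<^sup>2)"
    by (rule integrable_compact_support[of _ "cball 0 (real DIM('a) * K)"])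
       (use u_cont u_supp in \<open>auto intro!: continuous_on_power\<close>)

  have f_int: "integrable lborel (\<lambda>x. complex_of_real (f b x) * cis (- (x * \<omega>)))" if "b \<in> Basis" for b \<omega>
    by (rule integrable_compact_support[of _ "cball 0 K"])
       (use cont[OF that] supp[OF that] in \<open>auto intro!: continuous_intros\<close>)
  have g_prod: "g \<omega> = ?c * (\<Prod>b\<in>Basis. F b (\<omega> \<bullet> b))" for \<omega>
  proof -
    have "of_real (?u x) * cis (- (x \<bullet> \<omega>)) =
        (\<Prod>b\<in>Basis. of_real (f b (x \<bullet> b)) * cis (- ((x \<bullet> b) * (\<omega> \<bullet> b))))" for x
      by (subst euclidean_inner) (simp add: prod.distrib cis_sum flip: sum_negf)
    moreover have "g \<omega> = ?c * (LINT x|lborel. of_real (?u x) * cis (- (x \<bullet> \<omega>)))"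
      unfolding g_def by (rule truncated_fourier_compact_support[OF u_supp order_refl])
    ultimately show ?thesis
      unfolding F_def
      by (simp only:) (subst integral_lborel_prod[of "\<lambda>b t. of_real (f b t) * cis (- (t * (\<omega> \<bullet> b)))"];
        simp add: f_int)
  qed

  obtain C where C: "\<And>b \<omega>. b \<in> Basis \<Longrightarrow> cmod (F b \<omega>) * (1 + \<omega>\<^sup>2) ^ N \<le> C b"
    using decay unfolding F_def by metis
  have C0: "0 \<le> C b" if "b \<in> Basis" for b
    using C[OF that, of 0] by (auto intro: order_trans[OF norm_ge_zero])
  have decay1: "(1 + t\<^sup>2) powr m * (cmod (F b t))\<^sup>2 \<le> (C b)\<^sup>2 * inverse (1 + t\<^sup>2)" if "b \<in> Basis" for b t
  proof -
    have pos: "0 < 1 + t\<^sup>2" by (simp add: add_pos_nonneg)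
    have "(1 + t\<^sup>2) powr m * (1 + t\<^sup>2) \<le> ((1 + t\<^sup>2) ^ N)\<^sup>2"
    proof -
      have "(1 + t\<^sup>2) powr m * (1 + t\<^sup>2) = (1 + t\<^sup>2) powr (m + 1)"
        using pos by (simp add: powr_add)
      also have "\<dots> \<le> (1 + t\<^sup>2) powr (2 * real N)" using N by (intro powr_mono) auto
      also have "\<dots> = ((1 + t\<^sup>2) ^ N)\<^sup>2"
        using pos powr_realpow[of "1 + t\<^sup>2" "2 * N"] by (simp add: power_mult mult.commute flip: power_mult)
      finally show ?thesis .
    qed
    then have "(1 + t\<^sup>2) powr m * (1 + t\<^sup>2) * (cmod (F b t))\<^sup>2 \<le> ((1 + t\<^sup>2) ^ N)\<^sup>2 * (cmod (F b t))\<^sup>2"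
      by (intro mult_right_mono) auto
    also have "\<dots> \<le> (C b)\<^sup>2"
      using C[OF that, of t] pos by (auto simp: mult.commute simp flip: power_mult_distrib intro!: power_mono)
    finally show ?thesis using pos by (simp add: field_simps)
  qed
  have le: "?w \<omega> * (cmod (g \<omega>))\<^sup>2 \<le> (cmod ?c)\<^sup>2 * (\<Prod>b\<in>Basis. (C b)\<^sup>2 * inverse (1 + (\<omega> \<bullet> b)\<^sup>2))" for \<omega>
  proof -
    have "?w \<omega> * (cmod (g \<omega>))\<^sup>2 \<le> (\<Prod>b\<in>Basis. (1 + (\<omega> \<bullet> b)\<^sup>2) powr m) * (cmod (g \<omega>))\<^sup>2"
      using m by (intro mult_right_mono weight_le_prod) auto
    also have "\<dots> = (cmod ?c)\<^sup>2 * (\<Prod>b\<in>Basis. (1 + (\<omega> \<bullet> b)\<^sup>2) powr m * (cmod (F b (\<omega> \<bullet> b)))\<^sup>2)"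
      by (simp only: g_prod norm_mult power_mult_distrib prod_norm[symmetric] prod_power_distrib prod.distrib mult_ac)
    also have "\<dots> \<le> (cmod ?c)\<^sup>2 * (\<Prod>b\<in>Basis. (C b)\<^sup>2 * inverse (1 + (\<omega> \<bullet> b)\<^sup>2))"
      using decay1 by (intro mult_left_mono prod_mono) auto
    finally show ?thesis .
  qed
  have bound_int: "integrable lborel (\<lambda>\<omega>::'a. (cmod ?c)\<^sup>2 * (\<Prod>b\<in>Basis. (C b)\<^sup>2 * inverse (1 + (\<omega> \<bullet> b)\<^sup>2)))"
    by (intro integrable_mult_right integrable_lborel_prod integrable_inverse_1_plus_square_lborel)
  have [measurable]: "g \<in> borel_measurable borel"
    unfolding g_def by (intro truncated_fourier_measurable borel_measurable_continuous_onI u_cont)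
  have weighted: "integrable lborel (\<lambda>\<omega>. ?w \<omega> * (cmod (g \<omega>))\<^sup>2)"
    by (rule Bochner_Integration.integrable_bound[OF bound_int])
       (auto intro!: AE_I2 order_trans[OF le] abs_ge_self)
  \<comment> \<open>The weight is at least 1, so weighted integrability implies the unweighted
    one.\<close>
  have "(cmod (g \<omega>))\<^sup>2 \<le> ?w \<omega> * (cmod (g \<omega>))\<^sup>2" for \<omega>
    using m by (intro mult_le_cancel_right1[THEN iffD2]) (auto simp: ge_one_powr_ge_zero)
  then have "integrable lborel (\<lambda>\<omega>. (cmod (g \<omega>))\<^sup>2)"
    by (intro Bochner_Integration.integrable_bound[OF weighted]) auto
  then have "is_L2_fourier ?u g"
    using u_supp unfolding g_def by (intro is_L2_fourier_compact_support[OF u_cont]) auto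
  with u_cont u_sq weighted show ?thesis
    by (auto simp: sobolev_space_def)
qed

text \<open>A product of bumps lives on a box around \<open>c\<close>. If the box is small enough,
  each point of \<open>Y\<close> lies outside it in some coordinate, where the corresponding factor
  vanishes; dividing by the value at \<open>c\<close> normalizes.\<close>

lemma sobolev_space_separates:
  fixes c :: "'a::euclidean_space"
  assumes m: "m \<ge> 0" and Y: "finite Y" "c \<notin> Y"
  shows "\<exists>u\<in>sobolev_space m. u c = 1 \<and> (\<forall>y\<in>Y. u y = 0)"
proof -
  obtain N :: nat where N: "m + 1 \<le> 2 * real N" using real_nat_ceiling_ge[of "m + 1"] 
    by (metis mult_2 of_nat_add of_nat_le_iff le_add1 order_trans)
  with m have N0: "N > 0" by (intro Nat.gr0I) auto
  obtain \<delta> where \<delta>: "\<delta> > 0" "\<And>y. y \<in> Y \<Longrightarrow> \<exists>b\<in>Basis. \<delta> \<le> \<bar>y \<bullet> b - c \<bullet> b\<bar>"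
  proof -
    have "\<exists>\<delta>>0. \<forall>y\<in>Y. \<exists>b\<in>Basis. \<delta> \<le> \<bar>y \<bullet> b - c \<bullet> b\<bar>"
      using Y
    proof (induction Y rule: finite_induct)
      case empty
      show ?case by (auto intro: exI[of _ 1])
    next
      case (insert y Y)
      then obtain \<delta> where \<delta>: "\<delta> > 0" "\<forall>y\<in>Y. \<exists>b\<in>Basis. \<delta> \<le> \<bar>y \<bullet> b - c \<bullet> b\<bar>" by auto
      obtain b where b: "b \<in> Basis" "y \<bullet> b \<noteq> c \<bullet> b"
        using insert.prems euclidean_eqI[of y c] by auto
      let ?d = "min \<delta> \<bar>y \<bullet> b - c \<bullet> b\<bar>"
      have "?d > 0" using \<delta> b by auto
      moreover have "\<exists>b\<in>Basis. ?d \<le> \<bar>z \<bullet> b - c \<bullet> b\<bar>" if "z \<in> insert y Y" for z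
        using that \<delta>(2) b by (metis insert_iff min.coboundedI1 min.cobounded2)
      ultimately show ?case by blast
    qed
    then show ?thesis using that by blast
  qed
  let ?f = "\<lambda>b. bump \<delta> (2 * N) (c \<bullet> b)"
  let ?u = "\<lambda>x::'a. \<Prod>b\<in>Basis. ?f b (x \<bullet> b)"
  have "?u \<in> sobolev_space m"
  proof (rule tensor_sobolev[OF m N])
    \<comment> \<open>Since \<open>\<bar>c \<bullet> b\<bar> \<le> norm c\<close>, one radius serves
      for the supports of all factors.\<close>
    show "?f b x = 0" if "b \<in> Basis" "norm c + \<delta> < \<bar>x\<bar>" for b x
      using that Basis_le_norm[of b c] \<delta>(1) N0 by (intro bump_eq_0) auto
    show "continuous_on UNIV (?f b)" for b by (rule continuous_on_bump)
    show "\<exists>C. \<forall>\<omega>. cmod (LINT x|lborel. of_real (?f b x) * cis (- (x * \<omega>))) * (1 + \<omega>\<^sup>2) ^ N \<le> C" for b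
      using \<delta>(1) N0 by (intro fourier_bump_decay) auto
  qed
  moreover have "?u y = 0" if "y \<in> Y" for y
    using \<delta>(2)[OF that] \<delta>(1) N0 by (auto simp: intro!: bump_eq_0)
  moreover have "?u c \<noteq> 0" using \<delta>(1) by (simp add: bump_center)
  then have "inverse (?u c) * ?u c = 1" by (rule left_inverse)
  ultimately show ?thesis
    by (intro bexI[of _ "\<lambda>x. inverse (?u c) * ?u x"] sobolev_space_cmult) simp_all
qed

section \<open>Scalable functionals\<close>

context
  fixes m :: real and \<Lambda> :: "('a::euclidean_space \<Rightarrow> real) \<Rightarrow> real"
  assumes dual: "\<Lambda> \<in> sobolev_dual m"
begin

lemma sobolev_dual_add:
  "u \<in> sobolev_space m \<Longrightarrow> v \<in> sobolev_space m \<Longrightarrow> \<Lambda> (\<lambda>x. u x + v x) = \<Lambda> u + \<Lambda> v"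
  using dual by (simp add: sobolev_dual_def)

lemma sobolev_dual_cmult: "u \<in> sobolev_space m \<Longrightarrow> \<Lambda> (\<lambda>x. c * u x) = c * \<Lambda> u"
  using dual by (simp add: sobolev_dual_def)

lemma sobolev_dual_sum:
  assumes "finite A" "A \<noteq> {}" "\<And>i. i \<in> A \<Longrightarrow> f i \<in> sobolev_space m"
  shows "\<Lambda> (\<lambda>x. \<Sum>i\<in>A. f i x) = (\<Sum>i\<in>A. \<Lambda> (f i))"
  using assms
  by (induction A rule: finite_ne_induct) (simp_all add: sobolev_dual_add sobolev_space_sum)

text \<open>Lagrange interpolation: with functions \<open>\<phi> x\<close> that are 1 at
  \<open>x\<close> and 0 at the other nodes, \<open>u\<close> minus its interpolant vanishes on
  \<open>X\<close>, so \<open>\<Lambda>\<close> takes the same value on both. The coefficients are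
  the values \<open>\<Lambda> (\<phi> x)\<close>.\<close>

lemma sobolev_dual_eq_evaluations:
  assumes m: "m \<ge> 0" and X: "finite X"
    and vanish: "\<And>u. u \<in> sobolev_space m \<Longrightarrow> \<forall>x\<in>X. u x = 0 \<Longrightarrow> \<Lambda> u = 0"
  shows "\<exists>c. \<forall>u\<in>sobolev_space m. \<Lambda> u = (\<Sum>x\<in>X. c x * u x)"
proof (cases "X = {}")
  case False
  have "\<forall>x\<in>X. \<exists>u\<in>sobolev_space m. u x = 1 \<and> (\<forall>y\<in>X - {x}. u y = 0)"
    using X by (intro ballI sobolev_space_separates[OF m]) auto
  then obtain \<phi> where \<phi>: "\<And>x. x \<in> X \<Longrightarrow> \<phi> x \<in> sobolev_space m" "\<And>x. x \<in> X \<Longrightarrow> \<phi> x x = 1"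
    "\<And>x y. x \<in> X \<Longrightarrow> y \<in> X \<Longrightarrow> y \<noteq> x \<Longrightarrow> \<phi> x y = 0"
    by (metis Diff_iff singletonD)
  have "\<Lambda> u = (\<Sum>x\<in>X. \<Lambda> (\<phi> x) * u x)" if u: "u \<in> sobolev_space m" for u
  proof -
    let ?v = "\<lambda>y. \<Sum>x\<in>X. u x * \<phi> x y"
    have v: "?v \<in> sobolev_space m"
      using X False \<phi>(1) by (intro sobolev_space_sum sobolev_space_cmult) auto
    have "\<Lambda> (\<lambda>y. u y + (-1) * ?v y) = 0"
    proof (intro vanish sobolev_space_add[OF u sobolev_space_cmult[OF v]] ballI)
      fix y assume y: "y \<in> X"
      have "?v y = (\<Sum>x\<in>X. if x = y then u y else 0)"
        by (intro sum.cong refl) (use \<phi>(2,3) y in auto)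
      then show "u y + (-1) * ?v y = 0" using X y by simp
    qed
    then have "\<Lambda> u = \<Lambda> ?v"
      using sobolev_dual_add[OF u sobolev_space_cmult[OF v, of "-1"]] sobolev_dual_cmult[OF v, of "-1"] by simp
    also have "\<dots> = (\<Sum>x\<in>X. u x * \<Lambda> (\<phi> x))"
      using X False \<phi>(1) by (simp add: sobolev_dual_sum sobolev_space_cmult sobolev_dual_cmult)
    finally show ?thesis by (simp add: mult.commute)
  qed
  then show ?thesis by (intro exI[of _ "\<lambda>x. \<Lambda> (\<phi> x)"] ballI)
qed (use vanish in auto)

end

text \<open>A relation \<open>h *\<^sub>R y = x\<close> with \<open>x \<noteq> 0\<close> forces
  \<open>h = norm x / norm y\<close>. This excludes finitely many values only, while the interval
  between 0 and 1 is infinite.\<close>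

lemma exists_scale_avoiding:
  fixes X :: "'a::real_normed_vector set"
  assumes "finite X"
  shows "\<exists>h. 0 < h \<and> h < 1 \<and> (\<forall>x\<in>X. \<forall>y\<in>X. h *\<^sub>R y = x \<longrightarrow> x = 0)"
proof -
  have "finite ((\<lambda>(x, y). norm x / norm y) ` (X \<times> X))" using assms by auto
  then have "infinite ({0<..<1} - (\<lambda>(x, y). norm x / norm y) ` (X \<times> X) :: real set)"
    by (intro Diff_infinite_finite) auto
  then obtain h where h: "0 < h" "h < 1" "h \<notin> (\<lambda>(x, y). norm x / norm y) ` (X \<times> X)"
    by (metis DiffE ex_in_conv finite.emptyI greaterThanLessThan_iff)
  have "x = 0" if "x \<in> X" "y \<in> X" "h *\<^sub>R y = x" for x y
  proof (rule ccontr)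
    assume "x \<noteq> 0"
    then have "h = norm x / norm y" using that(3) h(1) by auto
    with h(3) that(1,2) show False by auto
  qed
  with h show ?thesis by blast
qed

lemma sobolev_dual_norm_upper:
  assumes "u \<in> sobolev_space m" "sobolev_norm m u \<le> 1"
  shows "ennreal \<bar>\<Lambda> u\<bar> \<le> sobolev_dual_norm m \<Lambda>"
  unfolding sobolev_dual_norm_def using assms by (intro SUP_upper) simp

text \<open>Scalability applied to the contraction \<open>u (x /\<^sub>R h)\<close>, whose
  stretching by \<open>h\<close> is \<open>u\<close> again.\<close>

lemma scalable_dilate:
  assumes "scalable m s \<Lambda>" "m \<ge> 0" "u \<in> sobolev_space m" and h: "0 < h" "h \<le> 1"
  shows "\<Lambda> u = h powr s * \<Lambda> (\<lambda>x. u (x /\<^sub>R h))"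
proof -
  have scale: "\<Lambda> (\<lambda>x. v (h *\<^sub>R x)) = h powr s * \<Lambda> v" if "v \<in> sobolev_space m" for v
    using assms(1) h that by (simp add: scalable_def)
  have "(\<lambda>x. u (x /\<^sub>R h)) \<in> sobolev_space m"
    by (rule sobolev_space_dilate[OF assms(3) h assms(2)])
  then have "\<Lambda> (\<lambda>x. u ((h *\<^sub>R x) /\<^sub>R h)) = h powr s * \<Lambda> (\<lambda>x. u (x /\<^sub>R h))"
    by (rule scale)
  with h show ?thesis by simp
qed

text \<open>Otherwise \<open>\<Lambda>\<close> is a combination of evaluations on \<open>X\<close>.
  Scalability removes the weights at nonzero nodes, so \<open>\<Lambda>\<close> would be zero or a
  multiple of the evaluation at 0, contrary to \<open>nz\<close> and \<open>n0\<close>.\<close>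

lemma scalable_nonvanishing:
  fixes \<Lambda> :: "('a::euclidean_space \<Rightarrow> real) \<Rightarrow> real"
  assumes m: "m \<ge> 0" and scal: "scalable m s \<Lambda>" and X: "finite X"
    and nz: "\<exists>u\<in>sobolev_space m. \<Lambda> u \<noteq> 0"
    and n0: "0 \<in> X \<Longrightarrow> \<not> (\<exists>c. \<forall>u\<in>sobolev_space m. \<Lambda> u = c * u 0)"
  shows "\<exists>u\<in>sobolev_space m. (\<forall>x\<in>X. u x = 0) \<and> \<Lambda> u \<noteq> 0"
proof (rule ccontr)
  assume "\<not> ?thesis"
  moreover have dual: "\<Lambda> \<in> sobolev_dual m" using scal by (simp add: scalable_def)
  ultimately obtain c where c: "\<And>u. u \<in> sobolev_space m \<Longrightarrow> \<Lambda> u = (\<Sum>x\<in>X. c x * u x)"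
    using sobolev_dual_eq_evaluations[OF dual m X] by blast
  obtain h where h: "0 < h" "h < 1" and avoid: "\<And>x y. x \<in> X \<Longrightarrow> y \<in> X \<Longrightarrow> h *\<^sub>R y = x \<Longrightarrow> x = 0"
    using exists_scale_avoiding[OF X] by blast
  have c0: "c x = 0" if x: "x \<in> X" "x \<noteq> 0" for x
  proof -
    \<comment> \<open>A function that is 1 at \<open>x\<close> and 0 on \<open>?Y\<close> sees only
      the weight \<open>c x\<close>, while its contraction by \<open>h\<close> vanishes on all of
      \<open>X\<close>. The choice of \<open>h\<close> keeps \<open>x\<close> out of the second
      set.\<close>
    let ?Y = "(X - {x}) \<union> (\<lambda>y. y /\<^sub>R h) ` X"
    have "x \<notin> ?Y" using avoid[OF _ x(1)] x(2) h(1) by force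
    then obtain \<phi> where \<phi>: "\<phi> \<in> sobolev_space m" "\<phi> x = 1" and \<phi>0: "\<And>y. y \<in> ?Y \<Longrightarrow> \<phi> y = 0"
      using sobolev_space_separates[OF m, of ?Y x] X by auto
    let ?\<psi> = "\<lambda>y. \<phi> (y /\<^sub>R h)"
    have \<psi>: "?\<psi> \<in> sobolev_space m" using sobolev_space_dilate[OF \<phi>(1)] h m by simp
    have "\<Lambda> \<phi> = h powr s * \<Lambda> ?\<psi>"
      using scalable_dilate[OF scal m \<phi>(1)] h by simp
    moreover have "\<phi> (y /\<^sub>R h) = 0" if "y \<in> X" for y
      by (rule \<phi>0) (use that in blast)
    then have "\<Lambda> ?\<psi> = 0" unfolding c[OF \<psi>] by simp
    moreover have "\<Lambda> \<phi> = (\<Sum>y\<in>X. if y = x then c x else 0)"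
      unfolding c[OF \<phi>(1)] using \<phi>(2) \<phi>0 by (intro sum.cong) auto
    ultimately show ?thesis using h X x by simp
  qed
  show False
  proof (cases "0 \<in> X")
    case True
    have "\<Lambda> u = c 0 * u 0" if "u \<in> sobolev_space m" for u
    proof -
      have "\<Lambda> u = (\<Sum>x\<in>X. if x = 0 then c 0 * u 0 else 0)"
        unfolding c[OF that] using c0 by (intro sum.cong) auto
      with X True show ?thesis by simp
    qed
    then show False using n0[OF True] by (meson exI ballI)
  next
    case False
    then have "c x = 0" if "x \<in> X" for x using c0[OF that] that by auto
    with c nz show False by simp
  qed
qed

section \<open>The upper bound for the convergence rate\<close>

theorem theorem5:
  fixes m s k :: real
    and \<Lambda> :: "('a::euclidean_space \<Rightarrow> real) \<Rightarrow> real"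
    and X :: "'a set"
    and a :: "real \<Rightarrow> 'a \<Rightarrow> real"
  assumes "m > real DIM('a) / 2"
    and "scalable m s \<Lambda>"
    and "\<exists>u\<in>sobolev_space m. \<Lambda> u \<noteq> 0"
    and "finite X"
    and "0 \<in> X \<Longrightarrow> \<not> (\<exists>c. \<forall>u\<in>sobolev_space m. \<Lambda> u = c * u 0)"
    and "has_convergence_rate m \<Lambda> X a k"
  shows "k \<le> m - s - real DIM('a) / 2"
proof (rule ccontr)
  let ?d = "real DIM('a)"
  assume "\<not> ?thesis"
  then have k: "k - (m - s - ?d / 2) > 0" by simp
  have "m \<ge> 0" using assms(1) by (rule less_imp_le[OF le_less_trans[rotated]]) simp
  then obtain u where u: "u \<in> sobolev_space m" "\<And>x. x \<in> X \<Longrightarrow> u x = 0" "\<Lambda> u \<noteq> 0"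
    using scalable_nonvanishing[OF _ assms(2,4,3,5)] by blast
  have dual: "\<Lambda> \<in> sobolev_dual m" using assms(2) by (simp add: scalable_def)
  obtain C where "C \<ge> 0" and C: "\<forall>\<^sub>F h in at_right 0.
      sobolev_dual_norm m (\<lambda>u. \<Lambda> u - nodal_functional (a h) X h u) \<le> ennreal (C * h powr k)"
    using assms(6) by (auto simp: has_convergence_rate_def)
  \<comment> \<open>Adding 1 makes \<open>B\<close> positive, so that division by it is safe without
    showing that the norm of \<open>u\<close> is nonzero.\<close>
  define B where "B = sobolev_norm m u + 1"
  have N0: "sobolev_norm m u \<ge> 0" by (simp add: sobolev_norm_def)
  then have B: "B > 0" "sobolev_norm m u \<le> B" by (auto simp: B_def)
  have "\<forall>\<^sub>F h in at_right (0::real). h < 1"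
    by (rule order_tendstoD[OF tendsto_ident_at]) simp
  with C eventually_at_right_less
  have "\<forall>\<^sub>F h in at_right 0. \<bar>\<Lambda> u\<bar> / B \<le> C * h powr (k - (m - s - ?d / 2))"
  proof eventually_elim
    case (elim h)
    \<comment> \<open>The power of \<open>h\<close> in \<open>?\<alpha>\<close> cancels the growth
      of the norm under contraction, and \<open>B\<close> dominates the norm of \<open>u\<close>;
      hence \<open>?\<alpha>\<close> times \<open>?v\<close> lies in the unit ball.\<close>
    let ?v = "\<lambda>x. u (x /\<^sub>R h)" and ?\<alpha> = "h powr (m - ?d / 2) / B"
    have v: "?v \<in> sobolev_space m"
      using sobolev_space_dilate[OF u(1)] elim \<open>m \<ge> 0\<close> by simp
    have "sobolev_norm m (\<lambda>x. ?\<alpha> * ?v x) \<le> ?\<alpha> * (h powr (?d / 2 - m) * sobolev_norm m u)"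
      unfolding sobolev_norm_cmult[OF v]
      using sobolev_norm_dilate_le[OF u(1)] elim \<open>m \<ge> 0\<close> B by (simp add: mult_left_mono divide_right_mono)
    also have "\<dots> = sobolev_norm m u / B"
      using elim by (simp flip: powr_add)
    also have "\<dots> \<le> 1" using B by simp
    finally have "ennreal \<bar>\<Lambda> (\<lambda>x. ?\<alpha> * ?v x) - nodal_functional (a h) X h (\<lambda>x. ?\<alpha> * ?v x)\<bar>
        \<le> sobolev_dual_norm m (\<lambda>u. \<Lambda> u - nodal_functional (a h) X h u)"
      by (rule sobolev_dual_norm_upper[OF sobolev_space_cmult[OF v],
          where \<Lambda> = "\<lambda>u. \<Lambda> u - nodal_functional (a h) X h u"])
    also have "\<dots> \<le> ennreal (C * h powr k)" by (rule elim)
    also have "nodal_functional (a h) X h (\<lambda>x. ?\<alpha> * ?v x) = 0"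
      using u(2) elim by (simp add: nodal_functional_def)
    also have "\<Lambda> (\<lambda>x. ?\<alpha> * ?v x) = ?\<alpha> * \<Lambda> ?v" by (rule sobolev_dual_cmult[OF dual v])
    finally have "?\<alpha> * \<bar>\<Lambda> ?v\<bar> \<le> C * h powr k"
      using \<open>C \<ge> 0\<close> B by (simp add: abs_mult)
    moreover have "\<Lambda> u = h powr s * \<Lambda> ?v"
      using elim by (intro scalable_dilate[OF assms(2) \<open>m \<ge> 0\<close> u(1)]) simp_all
    then have "\<bar>\<Lambda> u\<bar> = h powr s * \<bar>\<Lambda> ?v\<bar>" using elim by (simp add: abs_mult)
    moreover have "h powr (m - ?d / 2) = h powr (m - s - ?d / 2) * h powr s"
      by (simp flip: powr_add)
    ultimately have "h powr (m - s - ?d / 2) * (\<bar>\<Lambda> u\<bar> / B) \<le> C * h powr k"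
      by (simp add: mult_ac)
    \<comment> \<open>Extracting the common positive factor leaves a fixed number on the left and,
      on the right, a power of \<open>h\<close> whose exponent is the assumed excess of the
      rate.\<close>
    also have "C * h powr k = h powr (m - s - ?d / 2) * (C * h powr (k - (m - s - ?d / 2)))"
      by (simp add: mult.left_commute flip: powr_add)
    finally show ?case using elim by (simp only: mult_le_cancel_left_pos powr_gt_zero)
  qed
  \<comment> \<open>The exponent is positive by the negated claim, so the right side tends to 0 and
    forces the positive constant on the left to be at most 0.\<close>
  moreover have "((\<lambda>h. C * h powr (k - (m - s - ?d / 2))) \<longlongrightarrow> 0) (at_right 0)"
    using k by real_asymp
  ultimately have "\<bar>\<Lambda> u\<bar> / B \<le> 0"
    by (intro tendsto_lowerbound) auto
  with B u(3) show False by (simp add: divide_le_0_iff)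
qed

end
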